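(* The left overlap division $\mathcal O$ is a Gröbner involutive division: for every field $R$, every admissible monomial ordering $O$ on $R\langle x_1,\dots,x_n\rangle$ and every finite set $G$ of nonzero polynomials that is a Locally Involutive Basis with respect to $\mathcal O$ and $O$, the set $G$ is a (noncommutative) Gröbner Basis, with respect to $O$, of the two-sided ideal it generates.
   Context: Monomials are words in the noncommuting variables $x_1,\dots,x_n$; a monomial ordering (total order on monomials) is admissible if $1<m$ for all $m\neq 1$ and $m_1<m_2$ implies $\ell m_1 r<\ell m_2 r$ for all monomials $\ell,r$. $\mathrm{LM},\mathrm{LC}$ denote leading monomial and coefficient. A weak involutive division (one that is not strong) is called Gröbner if every Locally Involutive Basis with respect to it is a Gröbner Basis. An involutive division is a rule $I$ assigning to every finite set $U$ of monomials and every $u\in U$ a set $\mathcal M^L_I(u,U)\subseteq\{x_1,\dots,x_n\}$ of left multiplicative variables and a set $\mathcal M^R_I(u,U)\subseteq\{x_1,\dots,x_n\}$ of right multiplicative variables. For $u\in U$ and a factorisation $w=v_1uv_2$, $u$ is an involutive divisor of $w$ at this factorisation if (thin divisors) the last letter of $v_1$ (if $v_1\ne1$) is in $\mathcal M^L_I(u,U)$ and the first letter of $v_2$ (if $v_2\neq1$) is in $\mathcal M^R_I(u,U)$. For a finite set $P$ of nonzero polynomials, multiplicative variables of $p\in P$ are those of $\mathrm{LM}(p)$ with respect to $U=\mathrm{LM}(P)$. Involutive reduction of $f$ by $P$: repeatedly take the leading term $c\,w$ of the current polynomial; if some $\mathrm{LM}(p)$, $p\in P$, involutively divides $w$ at $w=v_1\mathrm{LM}(p)v_2$,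 subtract $c\,\mathrm{LC}(p)^{-1}v_1pv_2$; otherwise move $c\,w$ to the remainder. $f$ involutively reduces to zero using $P$ if the final remainder is $0$. $P$ is autoreduced if no $p\in P$ contains a term whose monomial is involutively divisible (multiplicative variables taken over $P$) by $\mathrm{LM}(p')$ for some $p'\in P\setminus\{p\}$. A left (right) prolongation of $p\in P$ is $x_ip$ with $x_i\notin\mathcal M^L_I(\mathrm{LM}(p),\mathrm{LM}(P))$ (resp. $px_i$ with $x_i\notin\mathcal M^R_I(\mathrm{LM}(p),\mathrm{LM}(P))$). An autoreduced $P$ is a Locally Involutive Basis if all left and right prolongations of its elements involutively reduce to zero using $P$. Left overlap division $\mathcal O$. Let $U$ be a finite set of monomials. All variables are left multiplicative for all elements of $U$. All variables are right multiplicative except those made right nonmultiplicative by the following rules: (a) whenever $u_j\in U$ occurs as a subword of a different $u_i\in U$ at a position that is not the suffix position, the letter of $u_i$ immediately to the right of that occurrence is right nonmultiplicative for $u_j$; (b) whenever $u_i,u_j\in U$ (possibly equal) and $1\le k<\min(\deg u_i,\deg u_j)$ are such that the prefix of $u_i$ of length $k$ equals the suffix of $u_j$ of length $k$, the $(k+1)$-st letter of $u_i$ is right nonmultiplicative for $u_j$. *)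

theory Defs
  imports HOL.Hull "HOL-Library.Poly_Mapping" "HOL-Library.Sublist"
begin

text \<open>
  Words form the free monoid under concatenation. Registering lists as an (additively written)
  monoid turns \<^typ>\<open>'v list \<Rightarrow>\<^sub>0 'k\<close> with its convolution product into the free
  associative algebra over \<^typ>\<open>'k\<close> in the noncommuting variables \<^typ>\<open>'v\<close>.
\<close>

instantiation list :: (type) monoid_add
begin

definition zero_list :: "'a list" where "zero_list = []"

definition plus_list :: "'a list \<Rightarrow> 'a list \<Rightarrow> 'a list" where "plus_list = (@)"

instance by standard (simp_all add: zero_list_def plus_list_def)

end

type_synonym 'v word = "'v list"

type_synonym ('v, 'k) ncpoly = "'v list \<Rightarrow>\<^sub>0 'k"


definition admissible :: "('v word \<Rightarrow> 'v word \<Rightarrow> bool) \<Rightarrow> bool" where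
  "admissible lt \<longleftrightarrow>
     irreflp lt \<and> transp lt \<and> totalp lt \<and>
     (\<forall>m. m \<noteq> [] \<longrightarrow> lt [] m) \<and>
     (\<forall>m1 m2 l r. lt m1 m2 \<longrightarrow> lt (l @ m1 @ r) (l @ m2 @ r))"

text \<open>Leading monomial and coefficient are only meaningful for nonzero polynomials.\<close>

definition lead_mon :: "('v word \<Rightarrow> 'v word \<Rightarrow> bool) \<Rightarrow> ('v, 'k::zero) ncpoly \<Rightarrow> 'v word" where
  "lead_mon lt p =
     (THE m. m \<in> Poly_Mapping.keys p \<and> (\<forall>m'\<in>Poly_Mapping.keys p. m' \<noteq> m \<longrightarrow> lt m' m))"

definition lead_coeff_nc :: "('v word \<Rightarrow> 'v word \<Rightarrow> bool) \<Rightarrow> ('v, 'k::zero) ncpoly \<Rightarrow> 'k" where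
  "lead_coeff_nc lt p = Poly_Mapping.lookup p (lead_mon lt p)"

definition lead_term :: "('v word \<Rightarrow> 'v word \<Rightarrow> bool) \<Rightarrow> ('v, 'k::zero) ncpoly \<Rightarrow> ('v, 'k) ncpoly" where
  "lead_term lt p = Poly_Mapping.single (lead_mon lt p) (lead_coeff_nc lt p)"


definition two_sided_ideal :: "'a::ring_1 set \<Rightarrow> bool" where
  "two_sided_ideal J \<longleftrightarrow>
     0 \<in> J \<and> (\<forall>p\<in>J. \<forall>q\<in>J. p + q \<in> J) \<and> (\<forall>a. \<forall>p\<in>J. a * p \<in> J \<and> p * a \<in> J)"

definition groebner_basis ::
    "('v word \<Rightarrow> 'v word \<Rightarrow> bool) \<Rightarrow> ('v, 'k::field) ncpoly set \<Rightarrow> ('v, 'k) ncpoly set \<Rightarrow> bool" where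
  "groebner_basis lt G J \<longleftrightarrow>
     two_sided_ideal J \<and> G \<subseteq> J \<and>
     (\<forall>f\<in>J. f \<noteq> 0 \<longrightarrow> (\<exists>g\<in>G. g \<noteq> 0 \<and> sublist (lead_mon lt g) (lead_mon lt f)))"


text \<open>
  An involutive division assigns to a finite set \<open>U\<close> of words and to \<open>u \<in> U\<close> the sets of left and
  right multiplicative variables; values at other arguments are irrelevant.
\<close>

record 'v inv_division =
  left_mult :: "'v word set \<Rightarrow> 'v word \<Rightarrow> 'v set"
  right_mult :: "'v word set \<Rightarrow> 'v word \<Rightarrow> 'v set"

definition inv_divides_at ::
    "'v inv_division \<Rightarrow> 'v word set \<Rightarrow> 'v word \<Rightarrow> 'v word \<Rightarrow> 'v word \<Rightarrow> 'v word \<Rightarrow> bool" where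
  "inv_divides_at D U u w v1 v2 \<longleftrightarrow>
     w = v1 @ u @ v2 \<and>
     (v1 \<noteq> [] \<longrightarrow> last v1 \<in> left_mult D U u) \<and>
     (v2 \<noteq> [] \<longrightarrow> hd v2 \<in> right_mult D U u)"

text \<open>
  \<open>inv_rem D lt P f r\<close>: some run of the involutive reduction of \<open>f\<close> by \<open>P\<close> stops with remainder
  \<open>r\<close>. The divisor and the factorisation used in a step need not be unique.
\<close>

inductive inv_rem ::
    "'v inv_division \<Rightarrow> ('v word \<Rightarrow> 'v word \<Rightarrow> bool) \<Rightarrow> ('v, 'k::field) ncpoly set
      \<Rightarrow> ('v, 'k) ncpoly \<Rightarrow> ('v, 'k) ncpoly \<Rightarrow> bool"
  for D lt P where
    stop: "inv_rem D lt P 0 0"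
  | reduce: "inv_rem D lt P f r"
      if "f \<noteq> 0" and "p \<in> P"
        and "inv_divides_at D (lead_mon lt ` P) (lead_mon lt p) (lead_mon lt f) v1 v2"
        and "inv_rem D lt P
               (f - Poly_Mapping.single v1 (lead_coeff_nc lt f * inverse (lead_coeff_nc lt p))
                      * p * Poly_Mapping.single v2 1) r"
  | move: "inv_rem D lt P f (lead_term lt f + r)"
      if "f \<noteq> 0"
        and "\<not> (\<exists>p\<in>P. \<exists>v1 v2.
                  inv_divides_at D (lead_mon lt ` P) (lead_mon lt p) (lead_mon lt f) v1 v2)"
        and "inv_rem D lt P (f - lead_term lt f) r"

definition inv_reduces_to_zero ::
    "'v inv_division \<Rightarrow> ('v word \<Rightarrow> 'v word \<Rightarrow> bool) \<Rightarrow> ('v, 'k::field) ncpoly set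
      \<Rightarrow> ('v, 'k) ncpoly \<Rightarrow> bool" where
  "inv_reduces_to_zero D lt P f \<longleftrightarrow> inv_rem D lt P f 0"

definition autoreduced ::
    "'v inv_division \<Rightarrow> ('v word \<Rightarrow> 'v word \<Rightarrow> bool) \<Rightarrow> ('v, 'k::field) ncpoly set \<Rightarrow> bool" where
  "autoreduced D lt P \<longleftrightarrow>
     \<not> (\<exists>p\<in>P. \<exists>m\<in>Poly_Mapping.keys p. \<exists>p'\<in>P - {p}. \<exists>v1 v2.
          inv_divides_at D (lead_mon lt ` P) (lead_mon lt p') m v1 v2)"

definition left_prolongations ::
    "'v inv_division \<Rightarrow> ('v word \<Rightarrow> 'v word \<Rightarrow> bool) \<Rightarrow> ('v, 'k::field) ncpoly set
      \<Rightarrow> ('v, 'k) ncpoly set" where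
  "left_prolongations D lt P =
     {Poly_Mapping.single [x] 1 * p |x p.
        p \<in> P \<and> x \<notin> left_mult D (lead_mon lt ` P) (lead_mon lt p)}"

definition right_prolongations ::
    "'v inv_division \<Rightarrow> ('v word \<Rightarrow> 'v word \<Rightarrow> bool) \<Rightarrow> ('v, 'k::field) ncpoly set
      \<Rightarrow> ('v, 'k) ncpoly set" where
  "right_prolongations D lt P =
     {p * Poly_Mapping.single [x] 1 |x p.
        p \<in> P \<and> x \<notin> right_mult D (lead_mon lt ` P) (lead_mon lt p)}"

definition locally_involutive_basis ::
    "'v inv_division \<Rightarrow> ('v word \<Rightarrow> 'v word \<Rightarrow> bool) \<Rightarrow> ('v, 'k::field) ncpoly set \<Rightarrow> bool" where
  "locally_involutive_basis D lt P \<longleftrightarrow>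
     autoreduced D lt P \<and>
     (\<forall>f \<in> left_prolongations D lt P \<union> right_prolongations D lt P.
        inv_reduces_to_zero D lt P f)"


definition subword_nonmult :: "'v word set \<Rightarrow> 'v word \<Rightarrow> 'v set" where
  "subword_nonmult U u = {x. \<exists>w\<in>U. w \<noteq> u \<and> (\<exists>a b. w = a @ u @ [x] @ b)}"

text \<open>Words are indexed from \<open>0\<close>, so \<open>w ! k\<close> is the letter of \<open>w\<close> in position \<open>k + 1\<close>.\<close>

definition overlap_nonmult :: "'v word set \<Rightarrow> 'v word \<Rightarrow> 'v set" where
  "overlap_nonmult U u =
     {w ! k |w k. w \<in> U \<and> 1 \<le> k \<and> k < min (length w) (length u) \<and>
        take k w = drop (length u - k) u}"

definition left_overlap_division :: "'v inv_division" where
  "left_overlap_division =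
     \<lparr> left_mult = (\<lambda>U u. UNIV),
       right_mult = (\<lambda>U u. UNIV - (subword_nonmult U u \<union> overlap_nonmult U u)) \<rparr>"

end

theory Submission
  imports Defs "HOL-Library.Ramsey"
begin

text \<open>
  Every term \<open>a g b\<close> of the ideal can be rewritten, using the prolongations of \<open>g\<close> that reduce to
  zero, into an involutive placement \<open>a' g' b'\<close> with the same leading monomial \<open>w\<close>, up to elements
  of the ideal represented below \<open>w\<close>: the letter after a nonmultiplicative placement is absorbed, so
  \<open>b'\<close> is shorter than \<open>b\<close>. By the choice of the nonmultiplicative variables, two different
  involutive placements in \<open>w\<close> never overlap, and disjoint placements are always equivalent modulo
  elements below \<open>w\<close>. Hence a representation whose largest monomial \<open>w\<close> exceeds the leading monomial
  can be replaced by one below \<open>w\<close>; this terminates because an admissible ordering over finitely many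
  letters is a well-order (it extends the subsequence order).
\<close>

section \<open>Admissible orderings are well-founded\<close>

text \<open>Ramsey's theorem: by transitivity all pairs of an infinite descending chain lie in
  \<open>r\<close>, and colouring them by \<open>A\<close> and \<open>B\<close> would give an
  infinite chain descending in one of the two.\<close>

lemma wf_trans_subset_Un:
  assumes "trans r" "r \<subseteq> A \<union> B" "wf A" "wf B"
  shows "wf r"
proof (rule trans_disj_wf_implies_wf[OF \<open>trans r\<close>])
  let ?T = "\<lambda>i::nat. if i = 0 then A else B"
  have "A \<union> B = (\<Union>i<2. ?T i)" by (simp add: numeral_2_eq_2 lessThan_Suc Un_commute)
  then show "disj_wf r"
    unfolding disj_wf using assms by (intro exI[of _ ?T] exI[of _ 2]) simp
qed

locale admissible_ordering =
  fixes lt :: "'v word \<Rightarrow> 'v word \<Rightarrow> bool"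
  assumes admissible: "admissible lt"
begin

lemma lt_irrefl [simp]: "\<not> lt m m"
  using admissible by (auto simp: admissible_def irreflp_def)

lemma lt_trans: "lt m1 m2 \<Longrightarrow> lt m2 m3 \<Longrightarrow> lt m1 m3"
  using admissible unfolding admissible_def by (blast dest: transpD)

lemma lt_total: "m1 \<noteq> m2 \<Longrightarrow> lt m1 m2 \<or> lt m2 m1"
  using admissible unfolding admissible_def by (metis UNIV_I totalp_onD)

lemma lt_Nil: "m \<noteq> [] \<Longrightarrow> lt [] m"
  using admissible by (simp add: admissible_def)

lemma lt_append: "lt m1 m2 \<Longrightarrow> lt (l @ m1 @ r) (l @ m2 @ r)"
  using admissible by (simp add: admissible_def)

text \<open>Prepending a letter enlarges a word, since the empty word is below the letter and the
  order is compatible with multiplication.\<close>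

lemma subseq_imp_lt: "subseq v w \<Longrightarrow> v = w \<or> lt v w"
proof (induction rule: list_emb.induct)
  case (list_emb_Nil ys)
  then show ?case using lt_Nil[of ys] by auto
next
  case (list_emb_Cons xs ys y)
  have "lt ys (y # ys)" using lt_append[OF lt_Nil, of "[y]" "[]" ys] by simp
  with list_emb_Cons.IH show ?case using lt_trans[of xs ys "y # ys"] by auto
next
  case (list_emb_Cons2 x y xs ys)
  then show ?case using lt_append[of xs ys "[y]" "[]"] by auto
qed

text \<open>Relative to a set of words, so that well-foundedness can be assembled piece by piece
  through unions and concatenations.\<close>

definition well_ordered :: "'v word set \<Rightarrow> bool" where
  "well_ordered S \<longleftrightarrow> (\<forall>Q\<subseteq>S. Q \<noteq> {} \<longrightarrow> (\<exists>m\<in>Q. \<forall>m'\<in>Q. \<not> lt m' m))"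

lemma well_ordered_subset: "well_ordered T \<Longrightarrow> S \<subseteq> T \<Longrightarrow> well_ordered S"
  unfolding well_ordered_def by blast

lemma well_ordered_empty: "well_ordered {}"
  unfolding well_ordered_def by blast

lemma well_ordered_singleton: "well_ordered {m}"
  unfolding well_ordered_def by (auto dest: subset_singletonD)

lemma well_ordered_Un:
  assumes "well_ordered S" "well_ordered T"
  shows "well_ordered (S \<union> T)"
  unfolding well_ordered_def
proof (intro allI impI)
  fix Q assume Q: "Q \<subseteq> S \<union> T" "Q \<noteq> {}"
  show "\<exists>m\<in>Q. \<forall>m'\<in>Q. \<not> lt m' m"
  proof (cases "Q \<inter> S = {} \<or> Q \<inter> T = {}")
    case True
    then have "Q \<subseteq> S \<or> Q \<subseteq> T" using Q by blast
    then have "well_ordered Q" using assms well_ordered_subset by blast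
    then show ?thesis using Q unfolding well_ordered_def by blast
  next
    case False
    obtain s where s: "s \<in> Q" "\<forall>m\<in>Q \<inter> S. \<not> lt m s"
      using assms(1)[unfolded well_ordered_def, rule_format, of "Q \<inter> S"] False by auto
    obtain t where t: "t \<in> Q" "\<forall>m\<in>Q \<inter> T. \<not> lt m t"
      using assms(2)[unfolded well_ordered_def, rule_format, of "Q \<inter> T"] False by auto
    show ?thesis
    proof (cases "lt s t")
      case True
      have "\<not> lt m s" if "m \<in> Q" for m
        using that Q(1) s(2) t(2) lt_trans[of m s t, OF _ True] by blast
      then show ?thesis using s(1) by blast
    next
      case False
      then have *: "lt m s" if "lt m t" for m using that lt_total[of t s] lt_trans[of m t s] by blast
      have "\<not> lt m t" if "m \<in> Q" for m
        using that Q(1) s(2) t(2) * by blast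
      then show ?thesis using t(1) by blast
    qed
  qed
qed

lemma well_ordered_imp_wf:
  assumes "well_ordered S"
  shows "wf {(m', m). m' \<in> S \<and> m \<in> S \<and> lt m' m}"
proof (rule wfI_min)
  fix x and Q :: "'v word set" assume "x \<in> Q"
  show "\<exists>z\<in>Q. \<forall>y. (y, z) \<in> {(m', m). m' \<in> S \<and> m \<in> S \<and> lt m' m} \<longrightarrow> y \<notin> Q"
  proof (cases "Q \<inter> S = {}")
    case True
    then show ?thesis using \<open>x \<in> Q\<close> by blast
  next
    case False
    then show ?thesis using assms[unfolded well_ordered_def, rule_format, of "Q \<inter> S"] by auto
  qed
qed

text \<open>If \<open>s @ t\<close> is smaller than \<open>s' @ t'\<close> then \<open>s\<close> is smaller than \<open>s'\<close> or \<open>t\<close> than \<open>t'\<close>, so the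
  order on concatenations is transitive and disjunctively well-founded.\<close>

lemma well_ordered_append:
  assumes S: "well_ordered S" and T: "well_ordered T"
  shows "well_ordered {s @ t |s t. s \<in> S \<and> t \<in> T}"
proof -
  let ?RS = "inv_image {(m', m). m' \<in> S \<and> m \<in> S \<and> lt m' m} fst :: ('v word \<times> 'v word) rel"
  let ?RT = "inv_image {(m', m). m' \<in> T \<and> m \<in> T \<and> lt m' m} snd :: ('v word \<times> 'v word) rel"
  let ?r = "{((s', t'), (s, t)). s' \<in> S \<and> t' \<in> T \<and> s \<in> S \<and> t \<in> T \<and> lt (s' @ t') (s @ t)}"
  have sub: "?r \<subseteq> ?RS \<union> ?RT"
  proof clarsimp
    fix s' t' s t
    assume "s' \<in> S" "t' \<in> T" "s \<in> S" "t \<in> T" and lt: "lt (s' @ t') (s @ t)" and "\<not> lt t' t"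
    then have t: "t = t' \<or> lt t t'" using lt_total by blast
    show "lt s' s"
    proof (rule ccontr)
      assume "\<not> lt s' s"
      then have s: "s = s' \<or> lt s s'" using lt_total by blast
      have "s @ t = s' @ t \<or> lt (s @ t) (s' @ t)" using s lt_append[of s s' "[]" t] by auto
      moreover have "s' @ t = s' @ t' \<or> lt (s' @ t) (s' @ t')"
        using t lt_append[of t t' s' "[]"] by auto
      ultimately have "s @ t = s' @ t' \<or> lt (s @ t) (s' @ t')"
        using lt_trans[of "s @ t" "s' @ t" "s' @ t'"] by metis
      then show False using lt lt_trans[of "s @ t" "s' @ t'" "s @ t"] by auto
    qed
  qed
  have "trans ?r" by (rule transI) (clarsimp, erule (1) lt_trans)
  then have wf: "wf ?r"
    using sub by (rule wf_trans_subset_Un)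
      (simp_all only: wf_inv_image well_ordered_imp_wf[OF S] well_ordered_imp_wf[OF T])
  show ?thesis
    unfolding well_ordered_def
  proof (intro allI impI)
    fix Q assume Q: "Q \<subseteq> {s @ t |s t. s \<in> S \<and> t \<in> T}" "Q \<noteq> {}"
    let ?P = "{(s, t). s \<in> S \<and> t \<in> T \<and> s @ t \<in> Q}"
    from Q obtain p where p: "p \<in> ?P" by blast
    obtain z where z: "z \<in> ?P" "\<And>y. (y, z) \<in> ?r \<Longrightarrow> y \<notin> ?P"
      by (rule wfE_min[OF wf p]) (rule that)
    obtain s t where st: "z = (s, t)" by (cases z)
    with z(1) have mem: "s \<in> S" "t \<in> T" "s @ t \<in> Q" by auto
    have "\<not> lt m' (s @ t)" if "m' \<in> Q" for m'
    proof
      assume lt: "lt m' (s @ t)"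
      obtain s' t' where s't': "m' = s' @ t'" "s' \<in> S" "t' \<in> T" using \<open>m' \<in> Q\<close> Q(1) by blast
      then have "((s', t'), z) \<in> ?r" using mem lt st by simp
      from z(2)[OF this] show False using s't' \<open>m' \<in> Q\<close> by simp
    qed
    then show "\<exists>m\<in>Q. \<forall>m'\<in>Q. \<not> lt m' m" using mem by blast
  qed
qed

text \<open>A word avoiding \<open>x # v\<close> either lacks \<open>x\<close> or splits at its
  first \<open>x\<close> into a prefix without \<open>x\<close>, that letter, and a rest avoiding
  \<open>v\<close>.\<close>

lemma well_ordered_avoiding:
  assumes "\<And>x. x \<in> A \<Longrightarrow> well_ordered (lists (A - {x}))" and "v \<in> lists A"
  shows "well_ordered {w \<in> lists A. \<not> subseq v w}"
  using assms(2)
proof (induction v)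
  case Nil
  then show ?case by (simp add: well_ordered_empty)
next
  case (Cons x v)
  let ?L = "lists (A - {x})"
  let ?N = "{w \<in> lists A. \<not> subseq v w}"
  let ?C = "{s @ t |s t. s \<in> ?L \<and> t \<in> {s @ t |s t. s \<in> {[x]} \<and> t \<in> ?N}}"
  have "well_ordered (?L \<union> ?C)"
    using Cons assms(1)
    by (intro well_ordered_Un well_ordered_append well_ordered_singleton) auto
  moreover have "{w \<in> lists A. \<not> subseq (x # v) w} \<subseteq> ?L \<union> ?C"
  proof (intro subsetI)
    fix w assume w: "w \<in> {w \<in> lists A. \<not> subseq (x # v) w}"
    show "w \<in> ?L \<union> ?C"
    proof (cases "x \<in> set w")
      case False
      then show ?thesis using w by auto
    next
      case True
      then obtain ys zs where ys: "w = ys @ x # zs" "x \<notin> set ys" by (meson split_list_first)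
      have "\<not> subseq v zs"
      proof
        assume "subseq v zs"
        then have "subseq (x # v) (x # zs)" by simp
        then have "subseq (x # v) w" using ys by (simp add: list_emb_append2)
        then show False using w by simp
      qed
      then have "[x] @ zs \<in> {s @ t |s t. s \<in> {[x]} \<and> t \<in> ?N}" using w ys by auto
      moreover have "ys \<in> ?L" using w ys by auto
      moreover have "w = ys @ [x] @ zs" using ys by simp
      ultimately show ?thesis by blast
    qed
  qed
  ultimately show ?case using well_ordered_subset by blast
qed

text \<open>Stands in for Higman's lemma: the elements of \<open>Q\<close> below a chosen
  \<open>v\<close> cannot contain \<open>v\<close> as a subsequence, so they lie in a set that is
  well-ordered by induction on the alphabet.\<close>

lemma well_ordered_lists:
  assumes "finite A"
  shows "well_ordered (lists A)"
  using assms
proof (induction A rule: finite_psubset_induct)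
  case (psubset A)
  show ?case
    unfolding well_ordered_def
  proof (intro allI impI)
    fix Q assume Q: "Q \<subseteq> lists A" "Q \<noteq> {}"
    then obtain v where v: "v \<in> Q" by blast
    let ?Q = "{w \<in> Q. lt w v}"
    show "\<exists>m\<in>Q. \<forall>m'\<in>Q. \<not> lt m' m"
    proof (cases "?Q = {}")
      case True
      then show ?thesis using v by blast
    next
      case False
      have "\<not> subseq v w" if "lt w v" for w
        using that subseq_imp_lt[of v w] lt_trans[of v w v] by auto
      then have "?Q \<subseteq> {w \<in> lists A. \<not> subseq v w}" using Q by auto
      moreover have "well_ordered {w \<in> lists A. \<not> subseq v w}"
        using v Q by (intro well_ordered_avoiding psubset.IH) auto
      ultimately obtain m where "m \<in> ?Q" "\<forall>m'\<in>?Q. \<not> lt m' m"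
        using False unfolding well_ordered_def by (elim allE[of _ ?Q]) auto
      then have m: "m \<in> Q" "lt m v" "\<And>m'. m' \<in> Q \<Longrightarrow> lt m' v \<Longrightarrow> \<not> lt m' m" by auto
      have "\<not> lt m' m" if "m' \<in> Q" for m'
        using m(3)[OF that] lt_trans[of m' m v, OF _ m(2)] by blast
      then show ?thesis using m(1) by blast
    qed
  qed
qed

lemma wfp_lt:
  assumes "finite (UNIV :: 'v set)"
  shows "wfp lt"
  using well_ordered_imp_wf[OF well_ordered_lists[OF assms]] by (simp add: wfp_def)

end


section \<open>Multiplying by monomials\<close>

lemma poly_mapping_add_single_induct [case_names zero add]:
  fixes f :: "'a \<Rightarrow>\<^sub>0 'b::comm_monoid_add"
  assumes zero: "P 0" and add: "\<And>f m c. P f \<Longrightarrow> P (f + Poly_Mapping.single m c)"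
  shows "P f"
proof (induction f rule: update_induct)
  case const
  then show ?case by (fact zero)
next
  case (update f a b)
  have "Poly_Mapping.update a b f = f + Poly_Mapping.single a b"
    using update(1)
    by (intro poly_mapping_eqI)
      (auto simp: lookup_update lookup_add lookup_single when_def in_keys_iff)
  with update add show ?case by simp
qed

lemma sum_single_lookup:
  fixes f :: "'a \<Rightarrow>\<^sub>0 'b::comm_monoid_add"
  shows "(\<Sum>m\<in>Poly_Mapping.keys f. Poly_Mapping.single m (Poly_Mapping.lookup f m)) = f"
  by (intro poly_mapping_eqI)
    (auto simp: lookup_sum lookup_single when_def in_keys_iff sum.delta')

lemma in_keys_diffD:
  fixes f g :: "'a \<Rightarrow>\<^sub>0 'b::ab_group_add"
  shows "m \<in> Poly_Mapping.keys (f - g) \<Longrightarrow> m \<in> Poly_Mapping.keys f \<or> m \<in> Poly_Mapping.keys g"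
  by (auto simp: in_keys_iff lookup_minus)

text \<open>The shape of a subtraction in \<open>inv_rem\<close>; the scalar always sits in the left
  factor, so that it can be tracked as one coefficient.\<close>

definition sandwich :: "'v word \<Rightarrow> 'k::comm_ring_1 \<Rightarrow> ('v, 'k) ncpoly \<Rightarrow> 'v word \<Rightarrow> ('v, 'k) ncpoly"
  where "sandwich a c f b = Poly_Mapping.single a c * f * Poly_Mapping.single b 1"

lemma sandwich_single:
  "sandwich a c (Poly_Mapping.single m d) b = Poly_Mapping.single (a @ m @ b) (c * d)"
  by (simp add: sandwich_def mult_single plus_list_def)

lemma sandwich_0 [simp]: "sandwich a c 0 b = 0"
  by (simp add: sandwich_def)

lemma sandwich_add: "sandwich a c (f + g) b = sandwich a c f b + sandwich a c g b"
  by (simp add: sandwich_def algebra_simps)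

lemma sandwich_diff: "sandwich a c (f - g) b = sandwich a c f b - sandwich a c g b"
  by (simp add: sandwich_def algebra_simps)

lemma sandwich_sum: "sandwich a c (sum f S) b = (\<Sum>i\<in>S. sandwich a c (f i) b)"
  by (simp add: sandwich_def sum_distrib_left sum_distrib_right)

lemma sandwich_coeff_add: "sandwich a (c + d) f b = sandwich a c f b + sandwich a d f b"
  by (simp add: sandwich_def single_add algebra_simps)

lemma sandwich_sandwich: "sandwich a c (sandwich l d f r) b = sandwich (a @ l) (c * d) f (r @ b)"
proof -
  have "sandwich a c (sandwich l d f r) b =
      (Poly_Mapping.single a c * Poly_Mapping.single l d) * f *
      (Poly_Mapping.single r 1 * Poly_Mapping.single b 1)"
    by (simp only: sandwich_def mult.assoc)
  then show ?thesis by (simp add: sandwich_def mult_single plus_list_def)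
qed

text \<open>Coefficients commute, so \<open>d\<close> may cross \<open>f\<close>, whereas the word
  \<open>m\<close> stays on its side.\<close>

lemma sandwich_mult_single_right:
  "sandwich a c (f * Poly_Mapping.single m d) b = sandwich a (c * d) f (m @ b)"
proof (induction f rule: poly_mapping_add_single_induct)
  case (add f m' c')
  then show ?case
    by (simp add: distrib_right sandwich_add mult_single plus_list_def sandwich_single ac_simps)
qed simp

lemma sandwich_mult_single_left:
  "sandwich a c (Poly_Mapping.single m d * f) b = sandwich (a @ m) (c * d) f b"
proof (induction f rule: poly_mapping_add_single_induct)
  case (add f m' c')
  then show ?case
    by (simp add: distrib_left sandwich_add mult_single plus_list_def sandwich_single ac_simps)
qed simp

lemma sandwich_Nil: "sandwich [] 1 f [] = f"
  by (simp add: sandwich_def flip: zero_list_def)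

lemma sandwich_uminus: "sandwich [] (-1) f [] = - f"
  by (simp add: sandwich_def single_uminus flip: zero_list_def)

lemma in_keys_sandwichE:
  assumes "k \<in> Poly_Mapping.keys (sandwich a c f b)"
  obtains m where "m \<in> Poly_Mapping.keys f" "k = a @ m @ b"
proof -
  from assms obtain x y where xy: "x \<in> Poly_Mapping.keys (Poly_Mapping.single a c * f)"
      "y \<in> Poly_Mapping.keys (Poly_Mapping.single b (1::'b))" "k = x + y"
    using keys_mult[of "Poly_Mapping.single a c * f" "Poly_Mapping.single b 1"]
    unfolding sandwich_def by blast
  then obtain x' m where "x' \<in> Poly_Mapping.keys (Poly_Mapping.single a c)"
      "m \<in> Poly_Mapping.keys f" "x = x' + m"
    using keys_mult[of "Poly_Mapping.single a c" f] by blast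
  with xy that[of m] show thesis by (auto simp: plus_list_def split: if_splits)
qed

text \<open>By cancellation in the free monoid no other monomial of \<open>f\<close> lands on
  \<open>a @ m @ b\<close>.\<close>

lemma lookup_sandwich: "Poly_Mapping.lookup (sandwich a c f b) (a @ m @ b) = c * Poly_Mapping.lookup f m"
proof (induction f rule: poly_mapping_add_single_induct)
  case (add f m' c')
  then show ?case
    by (simp add: sandwich_add sandwich_single lookup_add lookup_single when_def distrib_left)
qed simp


section \<open>Leading monomials and spans with bounded leading monomials\<close>

context admissible_ordering
begin

lemma finite_has_lt_greatest:
  assumes "finite A" "A \<noteq> {}"
  shows "\<exists>m\<in>A. \<forall>m'\<in>A. m' \<noteq> m \<longrightarrow> lt m' m"
  using assms
proof (induction A rule: finite_ne_induct)
  case (singleton x)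
  then show ?case by simp
next
  case (insert x F)
  then obtain m where m: "m \<in> F" "\<And>m'. m' \<in> F \<Longrightarrow> m' \<noteq> m \<Longrightarrow> lt m' m" by blast
  show ?case
  proof (cases "lt m x")
    case True
    then have "lt m' x" if "m' \<in> F" for m' using m(2)[OF that] lt_trans[of m' m x] by auto
    then show ?thesis by auto
  next
    case False
    then have "x = m \<or> lt x m" using lt_total by blast
    then show ?thesis using m by (intro bexI[of _ m]) auto
  qed
qed

lemma lead_mon_eqI:
  assumes "m \<in> Poly_Mapping.keys f" "\<And>m'. m' \<in> Poly_Mapping.keys f \<Longrightarrow> m' \<noteq> m \<Longrightarrow> lt m' m"
  shows "lead_mon lt f = m"
  unfolding lead_mon_def
proof (rule the_equality)
  fix k assume k: "k \<in> Poly_Mapping.keys f \<and> (\<forall>m'\<in>Poly_Mapping.keys f. m' \<noteq> k \<longrightarrow> lt m' k)"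
  show "k = m"
  proof (rule ccontr)
    assume "k \<noteq> m"
    then have "lt k m" "lt m k" using k assms by auto
    then show False using lt_trans[of k m k] by simp
  qed
qed (use assms in auto)

lemma lead_mon_greatest:
  assumes "f \<noteq> 0"
  shows "lead_mon lt f \<in> Poly_Mapping.keys f"
    and "\<And>m. m \<in> Poly_Mapping.keys f \<Longrightarrow> m = lead_mon lt f \<or> lt m (lead_mon lt f)"
proof -
  obtain k where "k \<in> Poly_Mapping.keys f" "\<forall>m'\<in>Poly_Mapping.keys f. m' \<noteq> k \<longrightarrow> lt m' k"
    using finite_has_lt_greatest[of "Poly_Mapping.keys f"] assms by auto
  moreover from this have "lead_mon lt f = k" by (intro lead_mon_eqI) auto
  ultimately show "lead_mon lt f \<in> Poly_Mapping.keys f"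
    "\<And>m. m \<in> Poly_Mapping.keys f \<Longrightarrow> m = lead_mon lt f \<or> lt m (lead_mon lt f)" by auto
qed

lemma lead_coeff_nonzero: "f \<noteq> 0 \<Longrightarrow> lead_coeff_nc lt f \<noteq> 0"
  using lead_mon_greatest(1)[of f] by (simp add: lead_coeff_nc_def in_keys_iff)

lemma keys_diff_lt:
  fixes f g :: "'v word \<Rightarrow>\<^sub>0 'k::ab_group_add"
  assumes "\<And>m. m \<in> Poly_Mapping.keys f \<Longrightarrow> m = w \<or> lt m w"
    and "\<And>m. m \<in> Poly_Mapping.keys g \<Longrightarrow> m = w \<or> lt m w"
    and "Poly_Mapping.lookup f w = Poly_Mapping.lookup g w"
    and "m \<in> Poly_Mapping.keys (f - g)"
  shows "lt m w"
proof -
  have "m \<noteq> w" using assms(3,4) by (auto simp: in_keys_iff lookup_minus)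
  then show ?thesis using assms(1,2)[of m] in_keys_diffD[OF assms(4)] by auto
qed

lemma keys_minus_lead_term:
  fixes f :: "('v, 'k::ab_group_add) ncpoly"
  assumes "m \<in> Poly_Mapping.keys (f - lead_term lt f)"
  shows "lt m (lead_mon lt f)"
proof (cases "f = 0")
  case True
  then show ?thesis using assms by (simp add: lead_term_def lead_coeff_nc_def)
next
  case False
  show ?thesis
    by (rule keys_diff_lt[OF lead_mon_greatest(2)[OF False] _ _ assms])
      (auto simp: lead_term_def lead_coeff_nc_def split: if_splits)
qed

lemma keys_sandwich_le:
  assumes "g \<noteq> 0" "m \<in> Poly_Mapping.keys (sandwich a c g b)"
  shows "m = a @ lead_mon lt g @ b \<or> lt m (a @ lead_mon lt g @ b)"
proof -
  obtain k where "k \<in> Poly_Mapping.keys g" "m = a @ k @ b"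
    using assms(2) by (rule in_keys_sandwichE)
  then show ?thesis using lead_mon_greatest(2)[OF assms(1), of k] lt_append by blast
qed

text \<open>For the trivial \<open>Q\<close> this is the two-sided ideal generated by
  \<open>G\<close>; for \<open>Q\<close> bounding by a word \<open>w\<close> it consists of the
  elements with a t-representation, t being \<open>w\<close>. \<open>Q\<close> constrains the top
  monomials of the summands, which may cancel in the sum.\<close>

inductive_set ideal_span ::
    "('v, 'k::field) ncpoly set \<Rightarrow> ('v word \<Rightarrow> bool) \<Rightarrow> ('v, 'k) ncpoly set"
  for G Q where
    zero: "0 \<in> ideal_span G Q"
  | add: "f \<in> ideal_span G Q \<Longrightarrow> g \<in> G \<Longrightarrow> Q (a @ lead_mon lt g @ b) \<Longrightarrow>
      f + sandwich a c g b \<in> ideal_span G Q"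

lemma ideal_span_gen: "g \<in> G \<Longrightarrow> Q (a @ lead_mon lt g @ b) \<Longrightarrow> sandwich a c g b \<in> ideal_span G Q"
  using ideal_span.add[OF ideal_span.zero, of g G Q a b c] by simp

lemma ideal_span_add:
  assumes "f \<in> ideal_span G Q" "h \<in> ideal_span G Q"
  shows "f + h \<in> ideal_span G Q"
  using assms(2)
proof induction
  case (add h g a b c)
  then show ?case using ideal_span.add[of "f + h" G Q g a b c] by (simp add: add.assoc)
qed (use assms in simp)

text \<open>Multiplies a representation term by term. With empty outer words it also gives closure
  under negation and the weakening of \<open>Q\<close>.\<close>

lemma ideal_span_sandwich:
  assumes "f \<in> ideal_span G Q" "\<And>m. Q m \<Longrightarrow> Q' (l @ m @ r)"
  shows "sandwich l d f r \<in> ideal_span G Q'"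
  using assms(1)
proof induction
  case (add f g a b c)
  then have "Q' ((l @ a) @ lead_mon lt g @ (b @ r))" using assms(2)[of "a @ lead_mon lt g @ b"] add.hyps(3) by simp
  then show ?case
    using ideal_span.add[OF add.IH add.hyps(2)] by (simp add: sandwich_add sandwich_sandwich)
qed (simp add: ideal_span.zero)

lemma ideal_span_uminus: "f \<in> ideal_span G Q \<Longrightarrow> - f \<in> ideal_span G Q"
  using ideal_span_sandwich[of f G Q Q "[]" "[]" "-1"] by (simp add: sandwich_uminus)

lemma ideal_span_diff:
  "f \<in> ideal_span G Q \<Longrightarrow> h \<in> ideal_span G Q \<Longrightarrow> f - h \<in> ideal_span G Q"
  using ideal_span_add[OF _ ideal_span_uminus, of f G Q h] by simp

lemma ideal_span_mono:
  assumes "f \<in> ideal_span G Q" "\<And>m. Q m \<Longrightarrow> Q' m"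
  shows "f \<in> ideal_span G Q'"
  using ideal_span_sandwich[of f G Q Q' "[]" "[]" 1] assms by (simp add: sandwich_Nil)

lemma ideal_span_sum:
  assumes "\<And>i. i \<in> S \<Longrightarrow> f i \<in> ideal_span G Q"
  shows "sum f S \<in> ideal_span G Q"
  using assms by (induction S rule: infinite_finite_induct) (auto intro: ideal_span.zero ideal_span_add)

text \<open>Expands \<open>h\<close> into its terms; this and its mirror image handle the tail
  products in \<open>cong_disjoint\<close>.\<close>

lemma ideal_span_mult_right:
  assumes "g \<in> G" "\<And>m. m \<in> Poly_Mapping.keys h \<Longrightarrow> Q (a @ lead_mon lt g @ m @ b)"
  shows "sandwich a c (g * h) b \<in> ideal_span G Q"
proof -
  have "sandwich a c (g * (\<Sum>m\<in>Poly_Mapping.keys h. Poly_Mapping.single m (Poly_Mapping.lookup h m))) b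
      \<in> ideal_span G Q"
    unfolding sum_distrib_left sandwich_sum sandwich_mult_single_right
    using assms by (intro ideal_span_sum ideal_span_gen) auto
  then show ?thesis by (simp only: sum_single_lookup)
qed

lemma ideal_span_mult_left:
  assumes "g \<in> G" "\<And>m. m \<in> Poly_Mapping.keys h \<Longrightarrow> Q (a @ m @ lead_mon lt g @ b)"
  shows "sandwich a c (h * g) b \<in> ideal_span G Q"
proof -
  have "sandwich a c ((\<Sum>m\<in>Poly_Mapping.keys h. Poly_Mapping.single m (Poly_Mapping.lookup h m)) * g) b
      \<in> ideal_span G Q"
    unfolding sum_distrib_right sandwich_sum sandwich_mult_single_left
    using assms by (intro ideal_span_sum ideal_span_gen) auto
  then show ?thesis by (simp only: sum_single_lookup)
qed

text \<open>Gives the inclusion of the generated ideal in the span. A factor \<open>a\<close> is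
  split into terms, each of which acts as a sandwich.\<close>

lemma two_sided_ideal_ideal_span:
  fixes G :: "('v, 'k::field) ncpoly set"
  shows "two_sided_ideal (ideal_span G (\<lambda>_. True))"
proof -
  have "a * p \<in> ideal_span G (\<lambda>_. True)" "p * a \<in> ideal_span G (\<lambda>_. True)"
    if p: "p \<in> ideal_span G (\<lambda>_. True)" for a p :: "('v, 'k) ncpoly"
  proof -
    have one: "Poly_Mapping.single [] 1 = (1 :: ('v, 'k) ncpoly)"
      by (simp flip: zero_list_def)
    have "Poly_Mapping.single m d * p \<in> ideal_span G (\<lambda>_. True)" for m d
      using ideal_span_sandwich[OF p, of "\<lambda>_. True" m "[]" d] by (simp add: sandwich_def one)
    then have "(\<Sum>m\<in>Poly_Mapping.keys a. Poly_Mapping.single m (Poly_Mapping.lookup a m)) * p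
        \<in> ideal_span G (\<lambda>_. True)"
      unfolding sum_distrib_right by (intro ideal_span_sum)
    then show "a * p \<in> ideal_span G (\<lambda>_. True)" by (simp only: sum_single_lookup)
    have "p * Poly_Mapping.single m d = sandwich [] d p m" for m d
      using sandwich_mult_single_right[of "[]" 1 p m d "[]"] by (simp add: sandwich_Nil)
    then have "p * Poly_Mapping.single m d \<in> ideal_span G (\<lambda>_. True)" for m d
      using ideal_span_sandwich[OF p, of "\<lambda>_. True" "[]" m d] by simp
    then have "p * (\<Sum>m\<in>Poly_Mapping.keys a. Poly_Mapping.single m (Poly_Mapping.lookup a m))
        \<in> ideal_span G (\<lambda>_. True)"
      unfolding sum_distrib_left by (intro ideal_span_sum)
    then show "p * a \<in> ideal_span G (\<lambda>_. True)" by (simp only: sum_single_lookup)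
  qed
  then show ?thesis
    unfolding two_sided_ideal_def using ideal_span.zero ideal_span_add by blast
qed

text \<open>A representation is a finite sum, so by totality its top monomials have a largest one.
  The case \<open>f = 0\<close> covers the empty sum, which offers no \<open>w\<close>.\<close>

lemma ideal_span_bound:
  assumes "f \<in> ideal_span G Q"
  shows "f = 0 \<or> (\<exists>w. Q w \<and> f \<in> ideal_span G (\<lambda>m. m = w \<or> lt m w))"
  using assms
proof induction
  case (add f g a b c)
  let ?w = "a @ lead_mon lt g @ b"
  have gen: "sandwich a c g b \<in> ideal_span G (\<lambda>m. m = w \<or> lt m w)" if "?w = w \<or> lt ?w w" for w
    using ideal_span_gen[OF add.hyps(2), of "\<lambda>m. m = w \<or> lt m w"] that by blast
  from add.IH show ?case
  proof
    assume "f = 0"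
    then show ?thesis using gen[of ?w] add.hyps(3) by auto
  next
    assume "\<exists>w. Q w \<and> f \<in> ideal_span G (\<lambda>m. m = w \<or> lt m w)"
    then obtain w where w: "Q w" "f \<in> ideal_span G (\<lambda>m. m = w \<or> lt m w)" by blast
    show ?thesis
    proof (cases "?w = w \<or> lt ?w w")
      case True
      then show ?thesis using w(1) ideal_span_add[OF w(2) gen] by blast
    next
      case False
      then have "lt w ?w" using lt_total by blast
      then have "f \<in> ideal_span G (\<lambda>m. m = ?w \<or> lt m ?w)"
        by (intro ideal_span_mono[OF w(2)]) (auto intro: lt_trans[of _ w ?w])
      then show ?thesis using ideal_span_add[OF _ gen[of ?w]] add.hyps(3) by blast
    qed
  qed
qed simp

lemma keys_ideal_span_lt:
  assumes "f \<in> ideal_span G (\<lambda>m. lt m w)" "0 \<notin> G" "m \<in> Poly_Mapping.keys f"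
  shows "lt m w"
  using assms(1,3)
proof (induction arbitrary: m)
  case (add f g a b c)
  then consider "m \<in> Poly_Mapping.keys f" | "m \<in> Poly_Mapping.keys (sandwich a c g b)"
    using Poly_Mapping.keys_add[of f "sandwich a c g b"] by blast
  then show ?case
  proof cases
    case 1
    then show ?thesis using add.IH by blast
  next
    case 2
    moreover have "g \<noteq> 0" using add.hyps assms(2) by blast
    ultimately show ?thesis
      using keys_sandwich_le add.hyps(3) lt_trans[of m "a @ lead_mon lt g @ b" w] by blast
  qed
qed simp

section \<open>Involutive reduction and representations below a word\<close>

lemma keys_inv_rem:
  assumes "inv_rem D lt P f r" "0 \<notin> P" "\<And>m. m \<in> Poly_Mapping.keys f \<Longrightarrow> lt m w"
    and "m \<in> Poly_Mapping.keys r"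
  shows "lt m w"
  using assms(1,3,4)
proof (induction arbitrary: m rule: inv_rem.induct)
  case (reduce f p v1 v2 r)
  let ?s = "sandwich v1 (lead_coeff_nc lt f * inverse (lead_coeff_nc lt p)) p v2"
  have lm: "lead_mon lt f = v1 @ lead_mon lt p @ v2"
    using reduce.hyps(3) by (simp add: inv_divides_at_def)
  have "p \<noteq> 0" using reduce.hyps(2) assms(2) by blast
  have w: "lt (lead_mon lt f) w" using reduce.prems(1) lead_mon_greatest(1)[OF reduce.hyps(1)] .
  have "lt k w" if k: "k \<in> Poly_Mapping.keys (f - ?s)" for k
  proof -
    consider "k \<in> Poly_Mapping.keys f" | "k \<in> Poly_Mapping.keys ?s"
      using in_keys_diffD[OF k] by blast
    then show ?thesis
    proof cases
      case 2
      then have "k = lead_mon lt f \<or> lt k (lead_mon lt f)"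
        using keys_sandwich_le[OF \<open>p \<noteq> 0\<close>] lm by simp
      then show ?thesis using w lt_trans[of k "lead_mon lt f" w] by blast
    qed (use reduce.prems in blast)
  qed
  then show ?case using reduce.IH reduce.prems(2) unfolding sandwich_def by blast
next
  case (move f r)
  have w: "lt (lead_mon lt f) w" using move.prems(1) lead_mon_greatest(1)[OF move.hyps(1)] .
  have "lt k w" if "k \<in> Poly_Mapping.keys (f - lead_term lt f)" for k
    using keys_minus_lead_term[OF that] w lt_trans[of k "lead_mon lt f" w] by blast
  moreover have "m \<in> Poly_Mapping.keys (lead_term lt f) \<or> m \<in> Poly_Mapping.keys r"
    using move.prems(2) Poly_Mapping.keys_add[of "lead_term lt f" r] by blast
  ultimately show ?case using move.IH w by (auto simp: lead_term_def split: if_splits)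
qed simp

text \<open>The term that a move step puts into the remainder can never cancel again.\<close>

lemma inv_rem_move_nonzero:
  assumes "inv_rem D lt P (f - lead_term lt f) r" "0 \<notin> P" "f \<noteq> 0"
  shows "lead_term lt f + r \<noteq> 0"
proof
  assume *: "lead_term lt f + r = 0"
  have "lt m (lead_mon lt f)" if "m \<in> Poly_Mapping.keys r" for m
    by (rule keys_inv_rem[OF assms(1,2) _ that]) (rule keys_minus_lead_term)
  then have "lead_mon lt f \<notin> Poly_Mapping.keys r" using lt_irrefl by blast
  then have "Poly_Mapping.lookup (lead_term lt f + r) (lead_mon lt f) = lead_coeff_nc lt f"
    by (simp add: lookup_add lead_term_def in_keys_iff)
  then show False using * lead_coeff_nonzero[OF assms(3)] by simp
qed

text \<open>A run with remainder 0 has no move step, so it writes \<open>f\<close> as the sum of the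
  subtracted multiples. The remainder is a variable with \<open>r = 0\<close> to let the rule
  induction go through.\<close>

lemma inv_rem_zero_imp_span:
  assumes "inv_rem D lt P f r" "0 \<notin> P" "r = 0" "\<And>m. m \<in> Poly_Mapping.keys f \<Longrightarrow> lt m w"
  shows "f \<in> ideal_span P (\<lambda>m. lt m w)"
  using assms(1,3,4)
proof (induction rule: inv_rem.induct)
  case stop
  then show ?case by (simp add: ideal_span.zero)
next
  case (reduce f p v1 v2 r)
  let ?s = "sandwich v1 (lead_coeff_nc lt f * inverse (lead_coeff_nc lt p)) p v2"
  have lm: "lead_mon lt f = v1 @ lead_mon lt p @ v2"
    using reduce.hyps(3) by (simp add: inv_divides_at_def)
  have "p \<noteq> 0" using reduce.hyps(2) assms(2) by blast
  have w: "lt (lead_mon lt f) w" using reduce.prems(2) lead_mon_greatest(1)[OF reduce.hyps(1)] .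
  have s: "?s \<in> ideal_span P (\<lambda>m. lt m w)"
    using w lm by (intro ideal_span_gen reduce.hyps(2)) simp
  have "lt k w" if k: "k \<in> Poly_Mapping.keys (f - ?s)" for k
  proof -
    have "k \<in> Poly_Mapping.keys f \<or> k \<in> Poly_Mapping.keys ?s"
      using that by (rule in_keys_diffD)
    then show ?thesis
      using reduce.prems(2) keys_ideal_span_lt[OF s assms(2)] by blast
  qed
  then have "f - ?s \<in> ideal_span P (\<lambda>m. lt m w)"
    using reduce.IH reduce.prems(1) unfolding sandwich_def by blast
  then show ?case using ideal_span_add[OF _ s] by fastforce
next
  case (move f r)
  then show ?case using inv_rem_move_nonzero assms(2) by blast
qed

text \<open>The first step is singled out because it cancels the leading term; the rest of the run
  then represents the difference strictly below it.\<close>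

lemma inv_reduces_to_zeroE:
  assumes "inv_reduces_to_zero D lt P f" "0 \<notin> P" "f \<noteq> 0"
  obtains p v1 v2 where "p \<in> P"
    and "inv_divides_at D (lead_mon lt ` P) (lead_mon lt p) (lead_mon lt f) v1 v2"
    and "f - sandwich v1 (lead_coeff_nc lt f * inverse (lead_coeff_nc lt p)) p v2
      \<in> ideal_span P (\<lambda>m. lt m (lead_mon lt f))"
  using assms(1)[unfolded inv_reduces_to_zero_def]
proof (cases rule: inv_rem.cases)
  case stop
  then show ?thesis using assms(3) by simp
next
  case (reduce p v1 v2)
  let ?s = "sandwich v1 (lead_coeff_nc lt f * inverse (lead_coeff_nc lt p)) p v2"
  have lm: "lead_mon lt f = v1 @ lead_mon lt p @ v2"
    using reduce by (simp add: inv_divides_at_def)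
  have "p \<noteq> 0" using reduce assms(2) by blast
  have "lt k (lead_mon lt f)" if "k \<in> Poly_Mapping.keys (f - ?s)" for k
  proof (rule keys_diff_lt[OF _ _ _ that])
    \<comment> \<open>The first \<open>simp\<close> expands the leading monomial so that
      \<open>lookup_sandwich\<close> applies; the second folds it back to compare the
      coefficients.\<close>
    show "Poly_Mapping.lookup f (lead_mon lt f) = Poly_Mapping.lookup ?s (lead_mon lt f)"
      using lead_coeff_nonzero[OF \<open>p \<noteq> 0\<close>]
      by (simp add: lm lookup_sandwich) (simp flip: lm add: lead_coeff_nc_def)
  qed (use lead_mon_greatest(2)[OF assms(3)] keys_sandwich_le[OF \<open>p \<noteq> 0\<close>] lm in auto)
  then have "f - ?s \<in> ideal_span P (\<lambda>m. lt m (lead_mon lt f))"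
    using reduce(4) assms(2) unfolding sandwich_def by (intro inv_rem_zero_imp_span[where r = 0]) auto
  then show ?thesis using that reduce by blast
next
  case (move r)
  then show ?thesis using inv_rem_move_nonzero[OF move(4) assms(2,3)] by simp
qed

end

section \<open>Involutive placements of leading monomials\<close>

locale left_overlap_basis = admissible_ordering lt
  for lt :: "'v word \<Rightarrow> 'v word \<Rightarrow> bool" +
  fixes G :: "('v, 'k::field) ncpoly set"
  assumes zero_notin: "0 \<notin> G"
    and involutive: "locally_involutive_basis left_overlap_division lt G"
begin

definition nonmult :: "'v word \<Rightarrow> 'v set" where
  "nonmult u = subword_nonmult (lead_mon lt ` G) u \<union> overlap_nonmult (lead_mon lt ` G) u"

lemma mem_right_mult_iff:
  "x \<in> right_mult left_overlap_division (lead_mon lt ` G) u \<longleftrightarrow> x \<notin> nonmult u"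
  by (simp add: left_overlap_division_def nonmult_def)

lemma inv_divides_at_iff:
  "inv_divides_at left_overlap_division (lead_mon lt ` G) u w v1 v2 \<longleftrightarrow>
    w = v1 @ u @ v2 \<and> (v2 \<noteq> [] \<longrightarrow> hd v2 \<notin> nonmult u)"
  by (simp add: inv_divides_at_def left_overlap_division_def nonmult_def)

lemma nonzero: "g \<in> G \<Longrightarrow> g \<noteq> 0"
  using zero_notin by blast

text \<open>A suffix occurrence always is an involutive divisor: every variable is left
  multiplicative and the right cofactor is empty. Autoreducedness then leaves only
  \<open>g = h\<close>.\<close>

lemma lead_mon_suffix_imp_eq:
  assumes "g \<in> G" "h \<in> G" "lead_mon lt g = v @ lead_mon lt h"
  shows "g = h"
proof (rule ccontr)
  assume "g \<noteq> h"
  have "inv_divides_at left_overlap_division (lead_mon lt ` G) (lead_mon lt h) (lead_mon lt g) v []"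
    using assms(3) by (simp add: inv_divides_at_iff)
  moreover have "h \<in> G - {g}" using assms(2) \<open>g \<noteq> h\<close> by simp
  ultimately have "\<not> autoreduced left_overlap_division lt G"
    unfolding autoreduced_def not_not
    by (intro bexI[of _ g] bexI[of _ "lead_mon lt g"] bexI[of _ h] exI)
      (use assms(1) lead_mon_greatest(1)[OF nonzero[OF assms(1)]] in auto)
  then show False using involutive by (simp add: locally_involutive_basis_def)
qed

text \<open>Forces the divisor of a prolongation to absorb the new letter \<open>x\<close>.
  Otherwise \<open>lead_mon lt p\<close> occurs inside \<open>lead_mon lt g\<close>: as a suffix it
  forces \<open>g = p\<close>, contradicting the choice of \<open>x\<close>; elsewhere the subword
  rule makes the next letter nonmultiplicative.\<close>

lemma nonmult_prolongation_divisor: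
  assumes "g \<in> G" "p \<in> G" "x \<in> nonmult (lead_mon lt g)"
    and "lead_mon lt g @ [x] = v1 @ lead_mon lt p @ v2"
    and "v2 \<noteq> [] \<Longrightarrow> hd v2 \<notin> nonmult (lead_mon lt p)"
  shows "v2 = []"
proof (rule ccontr)
  assume "v2 \<noteq> []"
  then obtain t where t: "v2 = t @ [x]" "lead_mon lt g = v1 @ lead_mon lt p @ t"
    using assms(4) by (cases v2 rule: rev_cases) auto
  show False
  proof (cases t)
    case Nil
    then have "g = p" using lead_mon_suffix_imp_eq[OF assms(1,2)] t by simp
    then show False using assms(3,5) t Nil by simp
  next
    case (Cons y t')
    have "y \<in> subword_nonmult (lead_mon lt ` G) (lead_mon lt p)"
      unfolding subword_nonmult_def
    proof (intro CollectI bexI[of _ "lead_mon lt g"] conjI exI)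
      show "lead_mon lt g = v1 @ lead_mon lt p @ [y] @ t'" using t Cons by simp
      then show "lead_mon lt g \<noteq> lead_mon lt p"
        by (auto dest: arg_cong[of _ _ length])
    qed (use assms(1) in simp)
    then show False using assms(5) t Cons by (simp add: nonmult_def)
  qed
qed

section \<open>Congruence of placements modulo lower representations\<close>

text \<open>The terms \<open>a g b\<close> and \<open>a' g' b'\<close> agree, after normalising the leading coefficients, up to
  elements of the ideal with a representation below their common leading monomial.\<close>

definition cong ::
    "'v word \<Rightarrow> ('v, 'k) ncpoly \<Rightarrow> 'v word \<Rightarrow> 'v word \<Rightarrow> ('v, 'k) ncpoly \<Rightarrow> 'v word \<Rightarrow> bool" where
  "cong a g b a' g' b' \<longleftrightarrow>
     (\<forall>c c'. c * lead_coeff_nc lt g = c' * lead_coeff_nc lt g' \<longrightarrow>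
        sandwich a c g b - sandwich a' c' g' b' \<in> ideal_span G (\<lambda>m. lt m (a @ lead_mon lt g @ b)))"

lemma cong_refl: "g \<in> G \<Longrightarrow> cong a g b a g b"
  using lead_coeff_nonzero[OF nonzero] by (auto simp: cong_def ideal_span.zero)

text \<open>The bound in \<open>cong\<close> is taken from the first placement, so exchanging the
  two relies on a common word.\<close>

lemma cong_sym:
  assumes "cong a g b a' g' b'" "a @ lead_mon lt g @ b = a' @ lead_mon lt g' @ b'"
  shows "cong a' g' b' a g b"
  unfolding cong_def
proof (intro allI impI)
  fix c c' assume "c * lead_coeff_nc lt g' = c' * lead_coeff_nc lt g"
  then have "sandwich a c' g b - sandwich a' c g' b' \<in> ideal_span G (\<lambda>m. lt m (a @ lead_mon lt g @ b))"
    using assms(1) by (simp add: cong_def)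
  from ideal_span_uminus[OF this]
  show "sandwich a' c g' b' - sandwich a c' g b \<in> ideal_span G (\<lambda>m. lt m (a' @ lead_mon lt g' @ b'))"
    using assms(2) by simp
qed

lemma cong_trans:
  assumes "cong a g b a' g' b'" "cong a' g' b' a'' g'' b''" "g' \<in> G"
    and "a @ lead_mon lt g @ b = a' @ lead_mon lt g' @ b'"
  shows "cong a g b a'' g'' b''"
  unfolding cong_def
proof (intro allI impI)
  fix c c'' assume eq: "c * lead_coeff_nc lt g = c'' * lead_coeff_nc lt g''"
  \<comment> \<open>The middle coefficient that matches both leading coefficients; it exists as
    \<open>g'\<close> is nonzero.\<close>
  define c' where "c' = c * lead_coeff_nc lt g / lead_coeff_nc lt g'"
  have c': "c * lead_coeff_nc lt g = c' * lead_coeff_nc lt g'"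
    using lead_coeff_nonzero[OF nonzero[OF assms(3)]] by (simp add: c'_def)
  have "sandwich a c g b - sandwich a' c' g' b' \<in> ideal_span G (\<lambda>m. lt m (a @ lead_mon lt g @ b))"
    using assms(1) c' unfolding cong_def by blast
  moreover have "sandwich a' c' g' b' - sandwich a'' c'' g'' b''
      \<in> ideal_span G (\<lambda>m. lt m (a @ lead_mon lt g @ b))"
    using assms(2) c' eq unfolding cong_def assms(4) by metis
  ultimately show "sandwich a c g b - sandwich a'' c'' g'' b''
      \<in> ideal_span G (\<lambda>m. lt m (a @ lead_mon lt g @ b))"
    using ideal_span_add by fastforce
qed

text \<open>Read off from the first reduction step of the prolongation by \<open>x\<close>: its
  divisor \<open>p\<close> ends with that letter, so the tail \<open>x # b\<close> shortens to
  \<open>b\<close>. Multiplying by \<open>a\<close> and \<open>b\<close> keeps the difference below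
  the common word.\<close>

lemma cong_prolongation:
  assumes "g \<in> G" "x \<in> nonmult (lead_mon lt g)"
  obtains p v where "p \<in> G" "lead_mon lt g @ [x] = v @ lead_mon lt p"
    and "\<And>a b. cong a g (x # b) (a @ v) p b"
proof -
  let ?F = "g * Poly_Mapping.single [x] 1"
  let ?w = "lead_mon lt g @ [x]"
  have F: "?F = sandwich [] 1 g [x]"
    using sandwich_mult_single_right[of "[]" 1 g "[x]" 1 "[]"] by (simp add: sandwich_Nil)
  have lookup: "Poly_Mapping.lookup ?F ?w = lead_coeff_nc lt g"
    using lookup_sandwich[of "[]" 1 g "[x]" "lead_mon lt g"] by (simp add: F lead_coeff_nc_def)
  have keys: "?w \<in> Poly_Mapping.keys ?F"
    using lookup lead_coeff_nonzero[OF nonzero[OF assms(1)]] by (simp add: in_keys_iff)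
  have lm: "lead_mon lt ?F = ?w"
    using keys_sandwich_le[OF nonzero[OF assms(1)], of _ "[]" 1 "[x]"] F
    by (intro lead_mon_eqI[OF keys]) auto
  have lc: "lead_coeff_nc lt ?F = lead_coeff_nc lt g"
    using lookup lm by (simp add: lead_coeff_nc_def)
  have "?F \<noteq> 0" using keys by auto
  have "?F \<in> right_prolongations left_overlap_division lt G"
    using assms by (auto simp: right_prolongations_def mem_right_mult_iff)
  then have "inv_reduces_to_zero left_overlap_division lt G ?F"
    using involutive by (simp add: locally_involutive_basis_def)
  from this zero_notin \<open>?F \<noteq> 0\<close> obtain p v1 v2 where p: "p \<in> G"
    and div: "inv_divides_at left_overlap_division (lead_mon lt ` G) (lead_mon lt p) (lead_mon lt ?F) v1 v2"
    and span: "?F - sandwich v1 (lead_coeff_nc lt ?F * inverse (lead_coeff_nc lt p)) p v2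
      \<in> ideal_span G (\<lambda>m. lt m (lead_mon lt ?F))"
    by (rule inv_reduces_to_zeroE)
  have div': "?w = v1 @ lead_mon lt p @ v2" "v2 \<noteq> [] \<Longrightarrow> hd v2 \<notin> nonmult (lead_mon lt p)"
    using div by (auto simp: inv_divides_at_iff lm)
  have v2: "v2 = []"
    using nonmult_prolongation_divisor[OF assms(1) p assms(2) div'] .
  have "cong a g (x # b) (a @ v1) p b" for a b
    unfolding cong_def
  proof (intro allI impI)
    fix c c' assume "c * lead_coeff_nc lt g = c' * lead_coeff_nc lt p"
    then have c': "c * (lead_coeff_nc lt g * inverse (lead_coeff_nc lt p)) = c'"
      using lead_coeff_nonzero[OF nonzero[OF p]] by (simp add: field_simps)
    have "sandwich a c (?F - sandwich v1 (lead_coeff_nc lt ?F * inverse (lead_coeff_nc lt p)) p v2) b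
        \<in> ideal_span G (\<lambda>m. lt m (a @ lead_mon lt g @ x # b))"
      by (rule ideal_span_sandwich[OF span]) (use lt_append[of _ ?w a b] lm in auto)
    then show "sandwich a c g (x # b) - sandwich (a @ v1) c' p b
        \<in> ideal_span G (\<lambda>m. lt m (a @ lead_mon lt g @ x # b))"
      unfolding lc unfolding F by (simp add: sandwich_diff sandwich_sandwich v2 c')
  qed
  then show thesis using that p div'(1) v2 by auto
qed

text \<open>Induction on the right cofactor, generalising \<open>a\<close> and \<open>g\<close>: a
  nonmultiplicative first letter is absorbed by \<open>cong_prolongation\<close>. Left cofactors may
  grow freely, as all variables are left multiplicative.\<close>

lemma cong_involutive_exists:
  assumes "g \<in> G"
  shows "\<exists>a' g' b'. g' \<in> G \<and> a @ lead_mon lt g @ b = a' @ lead_mon lt g' @ b' \<and>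
    (b' \<noteq> [] \<longrightarrow> hd b' \<notin> nonmult (lead_mon lt g')) \<and> cong a g b a' g' b'"
  using assms
proof (induction b arbitrary: a g)
  case Nil
  then show ?case using cong_refl by blast
next
  case (Cons x b)
  show ?case
  proof (cases "x \<in> nonmult (lead_mon lt g)")
    case False
    then show ?thesis using cong_refl[OF Cons.prems] Cons.prems
      by (intro exI[of _ a] exI[of _ g] exI[of _ "x # b"]) simp
  next
    case True
    obtain p v where p: "p \<in> G" "lead_mon lt g @ [x] = v @ lead_mon lt p"
      and c: "\<And>a b. cong a g (x # b) (a @ v) p b"
      using cong_prolongation[OF Cons.prems True] by blast
    have eq: "a @ lead_mon lt g @ x # b = (a @ v) @ lead_mon lt p @ b"
      using arg_cong[OF p(2), of "\<lambda>w. a @ w @ b"] by simp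
    obtain a' g' b' where "g' \<in> G" "(a @ v) @ lead_mon lt p @ b = a' @ lead_mon lt g' @ b'"
      "b' \<noteq> [] \<longrightarrow> hd b' \<notin> nonmult (lead_mon lt g')" "cong (a @ v) p b a' g' b'"
      using Cons.IH[OF p(1), of "a @ v"] by blast
    then show ?thesis using cong_trans[OF c _ p(1) eq] eq
      by (intro exI[of _ a'] exI[of _ g'] exI[of _ b']) simp
  qed
qed

text \<open>With \<open>u\<close>, \<open>u'\<close> the leading terms and \<open>t\<close>, \<open>t'\<close> the tails, the difference of \<open>g v u'\<close> and
  \<open>u v g'\<close> is \<open>t v g' - g v t'\<close>.\<close>

lemma cong_disjoint:
  assumes g: "g \<in> G" and g': "g' \<in> G"
  shows "cong a g (v @ lead_mon lt g' @ b) (a @ lead_mon lt g @ v) g' b"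
  unfolding cong_def
proof (intro allI impI)
  fix c c' assume eq: "c * lead_coeff_nc lt g = c' * lead_coeff_nc lt g'"
  let ?w = "a @ lead_mon lt g @ v @ lead_mon lt g' @ b"
  let ?V = "Poly_Mapping.single v 1 :: ('v, 'k) ncpoly"
  define d where "d = c * inverse (lead_coeff_nc lt g')"
  define t where "t = g - lead_term lt g"
  define t' where "t' = g' - lead_term lt g'"
  have d: "d * lead_coeff_nc lt g' = c" "d * lead_coeff_nc lt g = c'"
    using lead_coeff_nonzero[OF nonzero[OF g']] eq by (simp_all add: d_def field_simps)
  have 1: "sandwich a c g (v @ lead_mon lt g' @ b) = sandwich a d (g * ?V * lead_term lt g') b"
    using d(1) by (simp add: lead_term_def sandwich_mult_single_right)
  have 2: "sandwich (a @ lead_mon lt g @ v) c' g' b = sandwich a d (lead_term lt g * ?V * g') b"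
    using d(2) by (simp add: lead_term_def mult_single plus_list_def sandwich_mult_single_left)
  have "g * ?V * lead_term lt g' - lead_term lt g * ?V * g' = (t * ?V) * g' - g * (?V * t')"
    by (simp add: t_def t'_def algebra_simps)
  then have 3: "sandwich a c g (v @ lead_mon lt g' @ b) - sandwich (a @ lead_mon lt g @ v) c' g' b =
      sandwich a d ((t * ?V) * g') b - sandwich a d (g * (?V * t')) b"
    unfolding 1 2 by (simp only: flip: sandwich_diff)
  have "sandwich a d ((t * ?V) * g') b \<in> ideal_span G (\<lambda>m. lt m ?w)"
  proof (rule ideal_span_mult_left[OF g'])
    fix m assume "m \<in> Poly_Mapping.keys (t * ?V)"
    then obtain k where "k \<in> Poly_Mapping.keys t" "m = k @ v"
      using keys_mult[of t ?V] by (auto simp: plus_list_def)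
    then show "lt (a @ m @ lead_mon lt g' @ b) ?w"
      using lt_append[of k "lead_mon lt g" a "v @ lead_mon lt g' @ b"] keys_minus_lead_term[of k g]
      by (simp add: t_def)
  qed
  moreover have "sandwich a d (g * (?V * t')) b \<in> ideal_span G (\<lambda>m. lt m ?w)"
  proof (rule ideal_span_mult_right[OF g])
    fix m assume "m \<in> Poly_Mapping.keys (?V * t')"
    then obtain k where "k \<in> Poly_Mapping.keys t'" "m = v @ k"
      using keys_mult[of ?V t'] by (auto simp: plus_list_def)
    then show "lt (a @ lead_mon lt g @ m @ b) ?w"
      using lt_append[of k "lead_mon lt g'" "a @ lead_mon lt g @ v" b] keys_minus_lead_term[of k g']
      by (simp add: t'_def)
  qed
  ultimately show "sandwich a c g (v @ lead_mon lt g' @ b) - sandwich (a @ lead_mon lt g @ v) c' g' b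
      \<in> ideal_span G (\<lambda>m. lt m ?w)"
    unfolding 3 by (rule ideal_span_diff)
qed

section \<open>Comparing two placements in the same word\<close>

text \<open>If the first of two involutive placements ends earlier, the letter following it is
  multiplicative, which excludes that the placements meet.\<close>

lemma involutive_placements_disjoint:
  assumes "g \<in> G" "g' \<in> G"
    and eq: "a @ lead_mon lt g @ r = a' @ lead_mon lt g'"
    and "r \<noteq> []" "hd r \<notin> nonmult (lead_mon lt g)"
  obtains v where "a' = a @ lead_mon lt g @ v" "r = v @ lead_mon lt g'"
proof -
  let ?u = "lead_mon lt g" and ?u' = "lead_mon lt g'"
  have "(a @ ?u) @ r = a' @ ?u'" using eq by simp
  \<comment> \<open>Either \<open>t\<close> is the part of \<open>?u'\<close> lying before the end
    of \<open>?u\<close>, or it is the gap between the two.\<close>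
  then obtain t where "(a @ ?u = a' @ t \<and> t @ r = ?u') \<or> ((a @ ?u) @ t = a' \<and> r = t @ ?u')"
    unfolding append_eq_append_conv2 by blast
  then show thesis
  proof
    assume t: "a @ ?u = a' @ t \<and> t @ r = ?u'"
    have no_subword: "?u' \<noteq> s @ ?u @ r" for s
    proof
      assume s: "?u' = s @ ?u @ r"
      have "hd r \<in> subword_nonmult (lead_mon lt ` G) ?u"
        unfolding subword_nonmult_def
      proof (intro CollectI bexI[of _ ?u'] conjI exI)
        have "length ?u' \<noteq> length ?u" using s \<open>r \<noteq> []\<close> by simp
        then show "?u' \<noteq> ?u" by metis
        show "?u' = s @ ?u @ [hd r] @ tl r" using s \<open>r \<noteq> []\<close> by simp
      qed (use assms(2) in simp)
      then show False using assms(5) by (simp add: nonmult_def)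
    qed
    \<comment> \<open>Either \<open>?u\<close> lies inside \<open>?u'\<close>, or \<open>?u'\<close>
      starts after \<open>s\<close> letters of \<open>?u\<close> and the two share
      \<open>t\<close>.\<close>
    obtain s where "(a = a' @ s \<and> s @ ?u = t) \<or> (a @ s = a' \<and> ?u = s @ t)"
      using t unfolding append_eq_append_conv2 by blast
    then show thesis
    proof
      assume "a = a' @ s \<and> s @ ?u = t"
      then have "?u' = s @ ?u @ r" using t by auto
      then show thesis using no_subword by blast
    next
      assume s: "a @ s = a' \<and> ?u = s @ t"
      show thesis
      proof (cases "t = []")
        case True
        then show thesis using that[of "[]"] s t by simp
      next
        case False
        \<comment> \<open>An empty \<open>s\<close> would make \<open>?u\<close> a prefix of
          \<open>?u'\<close>; the overlap rule asks for \<open>length t < length ?u\<close>.\<close>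
        have "s \<noteq> []" using no_subword[of "[]"] s t by auto
        have "hd r \<in> overlap_nonmult (lead_mon lt ` G) ?u"
          unfolding overlap_nonmult_def
        \<comment> \<open>The overlap is \<open>t\<close>; position \<open>length t\<close> of
          \<open>?u'\<close>, counted from 0, holds the first letter of \<open>r\<close>.\<close>
        proof (intro CollectI exI[of _ ?u'] exI[of _ "length t"] conjI)
          have u': "?u' = t @ r" using t by simp
          show "hd r = ?u' ! length t" using u' \<open>r \<noteq> []\<close> by (simp add: nth_append hd_conv_nth)
          show "1 \<le> length t" using False by (cases t) auto
          show "length t < min (length ?u') (length ?u)" using s u' \<open>r \<noteq> []\<close> \<open>s \<noteq> []\<close> by simp
          show "take (length t) ?u' = drop (length ?u - length t) ?u" using s u' by simp
        qed (use assms(2) in simp)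
        then show thesis using assms(5) by (simp add: nonmult_def)
      qed
    qed
  next
    assume "(a @ ?u) @ t = a' \<and> r = t @ ?u'"
    then show thesis using that[of t] by simp
  qed
qed

text \<open>Cancelling the common tail \<open>b'\<close> leaves a placement of \<open>g'\<close> at
  the end of the word. If \<open>g\<close> ends there too, the suffix property gives
  \<open>g = g'\<close>; otherwise the placements are disjoint.\<close>

lemma cong_involutive_le:
  assumes "g \<in> G" "g' \<in> G"
    and eq: "a @ lead_mon lt g @ b = a' @ lead_mon lt g' @ b'"
    and inv: "b \<noteq> [] \<longrightarrow> hd b \<notin> nonmult (lead_mon lt g)"
    and le: "length b' \<le> length b"
  shows "cong a g b a' g' b'"
proof -
  have "(a @ lead_mon lt g) @ b = (a' @ lead_mon lt g') @ b'" using eq by simp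
  from append_eq_append_conv2[THEN iffD1, OF this]
  obtain r where r: "(a @ lead_mon lt g) @ r = a' @ lead_mon lt g'" "b = r @ b'"
    using le by fastforce
  show ?thesis
  proof (cases "r = []")
    case True
    have "a @ lead_mon lt g = a' @ lead_mon lt g'" using r True by simp
    then obtain s where "(a = a' @ s \<and> s @ lead_mon lt g = lead_mon lt g') \<or>
        (a @ s = a' \<and> lead_mon lt g = s @ lead_mon lt g')"
      unfolding append_eq_append_conv2 by blast
    then have "g = g'"
      using lead_mon_suffix_imp_eq[OF assms(1,2), of s] lead_mon_suffix_imp_eq[OF assms(2,1), of s]
      by auto
    then show ?thesis using cong_refl[OF assms(1)] r True by simp
  next
    case False
    moreover have "hd r \<notin> nonmult (lead_mon lt g)" using inv r(2) False by simp
    ultimately obtain v where "a' = a @ lead_mon lt g @ v" "r = v @ lead_mon lt g'"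
      using involutive_placements_disjoint[OF assms(1,2), of a r a'] r(1) by auto
    then show ?thesis using cong_disjoint[OF assms(1,2), of a v b'] r(2) by simp
  qed
qed

text \<open>The counterpart of resolving all overlaps: each placement is moved to an involutive one,
  and of these the one ending earlier is compared with the other.\<close>

lemma cong_same_word:
  assumes "g \<in> G" "g' \<in> G"
    and eq: "a @ lead_mon lt g @ b = a' @ lead_mon lt g' @ b'"
  shows "cong a g b a' g' b'"
proof -
  obtain a1 g1 b1 where 1: "g1 \<in> G" "a @ lead_mon lt g @ b = a1 @ lead_mon lt g1 @ b1"
    "b1 \<noteq> [] \<longrightarrow> hd b1 \<notin> nonmult (lead_mon lt g1)" "cong a g b a1 g1 b1"
    using cong_involutive_exists[OF assms(1)] by blast
  obtain a2 g2 b2 where 2: "g2 \<in> G" "a' @ lead_mon lt g' @ b' = a2 @ lead_mon lt g2 @ b2"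
    "b2 \<noteq> [] \<longrightarrow> hd b2 \<notin> nonmult (lead_mon lt g2)" "cong a' g' b' a2 g2 b2"
    using cong_involutive_exists[OF assms(2)] by blast
  have eq12: "a1 @ lead_mon lt g1 @ b1 = a2 @ lead_mon lt g2 @ b2" using 1(2) 2(2) eq by simp
  have "cong a1 g1 b1 a2 g2 b2"
  proof (cases "length b2 \<le> length b1")
    case True
    then show ?thesis using cong_involutive_le[OF 1(1) 2(1) eq12 1(3)] by blast
  next
    case False
    then have "cong a2 g2 b2 a1 g1 b1"
      using cong_involutive_le[OF 2(1) 1(1) eq12[symmetric] 2(3)] by simp
    then show ?thesis using cong_sym eq12 by metis
  qed
  moreover have "cong a2 g2 b2 a' g' b'" using cong_sym[OF 2(4) 2(2)] .
  ultimately have "cong a1 g1 b1 a' g' b'" using cong_trans 2(1) eq12 by metis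
  then show ?thesis using cong_trans 1 by metis
qed

section \<open>Lowering a representation to the leading monomial\<close>

text \<open>All summands with top monomial \<open>w\<close> merge into one multiple, since
  placements in \<open>w\<close> agree modulo lower ones. Requiring \<open>c \<noteq> 0\<close>
  makes \<open>w\<close> a monomial of \<open>f\<close>.\<close>

lemma ideal_span_le_collapse:
  assumes "f \<in> ideal_span G (\<lambda>m. m = w \<or> lt m w)"
  shows "f \<in> ideal_span G (\<lambda>m. lt m w) \<or>
    (\<exists>g\<in>G. \<exists>a b c. c \<noteq> 0 \<and> w = a @ lead_mon lt g @ b \<and>
      f - sandwich a c g b \<in> ideal_span G (\<lambda>m. lt m w))"
    (is "f \<in> ?B \<or> ?E f")
  using assms
proof induction
  case zero
  show ?case by (intro disjI1 ideal_span.zero)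
next
  case (add f g a b c)
  let ?s = "sandwich a c g b"
  show ?case
  proof (cases "lt (a @ lead_mon lt g @ b) w")
    case True
    have s: "?s \<in> ?B" by (intro ideal_span_gen add.hyps(2) True)
    from add.IH show ?thesis
    proof
      assume "f \<in> ?B"
      then show ?thesis by (intro disjI1 ideal_span_add s)
    next
      assume "?E f"
      then obtain g0 a0 b0 c0 where 0: "g0 \<in> G" "c0 \<noteq> 0" "w = a0 @ lead_mon lt g0 @ b0"
        "f - sandwich a0 c0 g0 b0 \<in> ?B" by blast
      have "f + ?s - sandwich a0 c0 g0 b0 \<in> ?B"
        using ideal_span_add[OF 0(4) s] by (simp add: algebra_simps)
      then show ?thesis using 0 by blast
    qed
  next
    case False
    then have w: "w = a @ lead_mon lt g @ b" using add.hyps(3) by blast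
    from add.IH show ?thesis
    proof
      assume f: "f \<in> ?B"
      show ?thesis
      proof (cases "c = 0")
        case True
        then show ?thesis using f by (intro disjI1) (simp add: sandwich_def)
      next
        case False
        have "f + ?s - ?s \<in> ?B" using f by simp
        then show ?thesis using False w add.hyps(2) by blast
      qed
    next
      assume "?E f"
      then obtain g0 a0 b0 c0 where 0: "g0 \<in> G" "c0 \<noteq> 0" "w = a0 @ lead_mon lt g0 @ b0"
        "f - sandwich a0 c0 g0 b0 \<in> ?B" by blast
      \<comment> \<open>Chosen so that both placements get the same coefficient at \<open>w\<close>
        and \<open>cong\<close> applies.\<close>
      define c' where "c' = c * lead_coeff_nc lt g / lead_coeff_nc lt g0"
      have "c * lead_coeff_nc lt g = c' * lead_coeff_nc lt g0"
        using lead_coeff_nonzero[OF nonzero[OF 0(1)]] by (simp add: c'_def)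
      moreover have "cong a g b a0 g0 b0" using cong_same_word[OF add.hyps(2) 0(1)] w 0(3) by simp
      ultimately have "?s - sandwich a0 c' g0 b0 \<in> ?B" unfolding cong_def w by blast
      from ideal_span_add[OF 0(4) this]
      have *: "f + ?s - sandwich a0 (c0 + c') g0 b0 \<in> ?B"
        by (simp add: sandwich_coeff_add algebra_simps)
      show ?thesis
      proof (cases "c0 + c' = 0")
        case True
        then show ?thesis using * by (intro disjI1) (simp add: sandwich_def)
      next
        case False
        then show ?thesis using * 0 by blast
      qed
    qed
  qed
qed

text \<open>Well-founded induction on the bound \<open>w\<close>: if the top summands cancel,
  \<open>ideal_span_bound\<close> supplies a smaller bound; if one remains, \<open>w\<close> is the
  leading monomial of \<open>f\<close>.\<close>

lemma ideal_span_le_lead_mon: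
  assumes "wfp lt" and "f \<in> ideal_span G (\<lambda>m. m = w \<or> lt m w)" and "f \<noteq> 0"
  shows "\<exists>g\<in>G. sublist (lead_mon lt g) (lead_mon lt f)"
  using assms(1,2)
proof (induction w rule: wfp_induct_rule)
  case (less w)
  from ideal_span_le_collapse[OF less.prems] show ?case
  proof
    assume "f \<in> ideal_span G (\<lambda>m. lt m w)"
    from ideal_span_bound[OF this] assms(3)
    obtain w' where "lt w' w" "f \<in> ideal_span G (\<lambda>m. m = w' \<or> lt m w')" by blast
    then show ?thesis using less.IH by blast
  next
    assume "\<exists>g\<in>G. \<exists>a b c. c \<noteq> 0 \<and> w = a @ lead_mon lt g @ b \<and>
      f - sandwich a c g b \<in> ideal_span G (\<lambda>m. lt m w)"
    then obtain g a b c where g: "g \<in> G" "c \<noteq> 0" "w = a @ lead_mon lt g @ b"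
      "f - sandwich a c g b \<in> ideal_span G (\<lambda>m. lt m w)" by blast
    let ?s = "sandwich a c g b"
    have lower: "lt m w" if "m \<in> Poly_Mapping.keys (f - ?s)" for m
      using keys_ideal_span_lt[OF g(4) zero_notin that] .
    \<comment> \<open>Nothing in the difference reaches \<open>w\<close>, so \<open>f\<close> has at
      \<open>w\<close> the nonzero coefficient of the single sandwich.\<close>
    have "Poly_Mapping.lookup (f - ?s) w = 0" using lower[of w] by (auto simp: in_keys_iff)
    then have "Poly_Mapping.lookup f w = c * lead_coeff_nc lt g"
      by (simp add: lookup_minus g(3) lookup_sandwich lead_coeff_nc_def)
    then have w: "w \<in> Poly_Mapping.keys f"
      using g(2) lead_coeff_nonzero[OF nonzero[OF g(1)]] by (simp add: in_keys_iff)
    have "lead_mon lt f = w"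
    proof (rule lead_mon_eqI[OF w])
      fix m assume m: "m \<in> Poly_Mapping.keys f" "m \<noteq> w"
      have "f = (f - ?s) + ?s" by simp
      then have "m \<in> Poly_Mapping.keys (f - ?s) \<or> m \<in> Poly_Mapping.keys ?s"
        using m(1) Poly_Mapping.keys_add[of "f - ?s" ?s] by auto
      then show "lt m w" using lower keys_sandwich_le[OF nonzero[OF g(1)]] g(3) m(2) by blast
    qed
    then show ?thesis using g(1,3) by (auto simp: sublist_def)
  qed
qed

end

theorem proposition5p5p16:
  fixes lt :: "'v::finite word \<Rightarrow> 'v word \<Rightarrow> bool"
    and G :: "('v, 'k::field) ncpoly set"
  assumes "admissible lt"
    and "finite G" and "0 \<notin> G"
    and "locally_involutive_basis left_overlap_division lt G"
  shows "groebner_basis lt G (two_sided_ideal hull G)"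
proof -
  interpret left_overlap_basis lt G
    by unfold_locales (use assms in auto)
  have "two_sided_ideal (two_sided_ideal hull G)"
    \<comment> \<open>\<open>hull_in\<close> asks for closure of two-sided ideals under
      intersections.\<close>
    by (rule hull_in) (auto simp: two_sided_ideal_def)
  moreover have "G \<subseteq> two_sided_ideal hull G" by (rule hull_subset)
  moreover have "\<exists>g\<in>G. g \<noteq> 0 \<and> sublist (lead_mon lt g) (lead_mon lt f)"
    if f: "f \<in> two_sided_ideal hull G" "f \<noteq> 0" for f
  proof -
    have "g \<in> ideal_span G (\<lambda>_. True)" if "g \<in> G" for g
      using ideal_span_gen[OF that, of "\<lambda>_. True" "[]" "[]" 1] by (simp add: sandwich_Nil)
    then have "two_sided_ideal hull G \<subseteq> ideal_span G (\<lambda>_. True)"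
      by (intro hull_minimal two_sided_ideal_ideal_span) blast
    then obtain w where "f \<in> ideal_span G (\<lambda>m. m = w \<or> lt m w)"
      using ideal_span_bound[of f G "\<lambda>_. True"] f by blast
    moreover have "wfp lt" by (rule wfp_lt) simp
    ultimately show ?thesis using ideal_span_le_lead_mon f(2) nonzero by blast
  qed
  ultimately show ?thesis unfolding groebner_basis_def by blast
qed

end
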